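(* Let $\omega:[0,\infty)\to[0,\infty)$ be a non-decreasing continuous function such that $\omega(t)=0$ implies $t=0$, and let $0<\alpha\le 1$. Let $y:[0,\infty)\to[0,\infty)$ be a continuous function, $$\int_0^\infty\omega\big(y(t)\big)\frac{1}{(1+t)^\alpha}\,dt<\infty,$$ and $$y(t)-y(s)\le\int_s^t h(\xi)\,d\xi,\qquad 0\le s\le t,$$ where $h:[0,\infty)\to[0,\infty)$ is a (measurable) function. If $$A:=\limsup_{t\to\infty}h(t)t^\alpha<\infty,$$ then $$\lim_{t\to\infty}y(t)=0.$$
   Context: The integral of the nonnegative function $h$ is the Lebesgue integral. *)

theory Defs
  imports "HOL-Analysis.Analysis"
begin

end

theory Submission
  imports Defs
begin

text \<open>
  The weight \<open>(1 + t) powr -\<alpha>\<close> has a natural length scale: around a large time \<open>t\<close>, the window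
  \<open>[t - \<kappa> (1 + t) powr \<alpha>, t]\<close> carries weight at least \<open>\<kappa>\<close>, and since \<open>\<alpha> \<le> 1\<close> it moves off to
  infinity with \<open>t\<close> when \<open>\<kappa> \<le> 1/2\<close>. On the same window the growth of \<open>y\<close> is controlled: as
  \<open>h \<xi> \<le> C * \<xi> powr -\<alpha>\<close> for large \<open>\<xi>\<close>, the function \<open>y\<close> increases by at most \<open>4 * C * \<kappa>\<close> there.

  So if \<open>y t \<ge> 2 * e\<close> at a large time \<open>t\<close> and \<open>4 * C * \<kappa> \<le> e\<close>, then \<open>y \<ge> e\<close> on the entire window
  (lemma \<open>growth_over_window\<close>), and by monotonicity of \<open>\<omega>\<close> the window contributes at least
  \<open>\<omega> e * \<kappa> > 0\<close> to the weighted integral of \<open>\<omega> \<circ> y\<close>. This is impossible once the window lies so far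
  out that the tail of the convergent integral is below \<open>\<omega> e * \<kappa>\<close> (lemma \<open>nn_integral_tail_less\<close>).
  Fixing the window explicitly, instead of choosing its left end so that it carries a prescribed
  weight, avoids any computation with the antiderivative of the weight and any case split at
  \<open>\<alpha> = 1\<close>.
\<close>

text \<open>
  The tails converge pointwise to \<open>0\<close> and are dominated by the full integrand, so dominated
  convergence applies along the integers; monotonicity in the domain gives all real starting points.
\<close>

lemma nn_integral_tail_less:
  fixes f :: "real \<Rightarrow> ennreal" and a :: real
  assumes meas: "(\<lambda>x. f x * indicator {a..} x) \<in> borel_measurable lebesgue"
    and fin: "(\<integral>\<^sup>+ x\<in>{a..}. f x \<partial>lebesgue) < \<infinity>"
    and "0 < \<eta>"
  shows "\<exists>T\<ge>a. \<forall>s\<ge>T. (\<integral>\<^sup>+ x\<in>{s..}. f x \<partial>lebesgue) < \<eta>"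
proof -
  define u where "u n x = f x * indicator {a..} x * indicator {real n..} x" for n x
  have "(\<lambda>n. \<integral>\<^sup>+ x. u n x \<partial>lebesgue) \<longlonglongrightarrow> (\<integral>\<^sup>+ x. 0 \<partial>(lebesgue :: real measure))"
  proof (rule nn_integral_dominated_convergence[where w = "\<lambda>x. f x * indicator {a..} x"])
    show "u n \<in> borel_measurable lebesgue" for n
      unfolding u_def by (intro borel_measurable_times_ennreal meas borel_measurable_indicator) simp
    show "AE x in lebesgue. u n x \<le> f x * indicator {a..} x" for n
      by (simp add: u_def indicator_def)
    show "AE x in lebesgue. (\<lambda>n. u n x) \<longlonglongrightarrow> 0"
    proof (rule AE_I2)
      fix x :: real
      have "eventually (\<lambda>n. u n x = 0) sequentially"
        using eventually_gt_at_top[of "nat \<lceil>\<bar>x\<bar>\<rceil>"]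
      proof eventually_elim
        case (elim n)
        hence "x < real n" by linarith
        thus ?case by (simp add: u_def)
      qed
      thus "(\<lambda>n. u n x) \<longlonglongrightarrow> 0" by (rule tendsto_eventually)
    qed
  qed (use meas fin in auto)
  hence "eventually (\<lambda>n. (\<integral>\<^sup>+ x. u n x \<partial>lebesgue) < \<eta>) sequentially"
    using \<open>0 < \<eta>\<close> by (auto dest: order_tendstoD(2))
  then obtain n where n: "(\<integral>\<^sup>+ x. u n x \<partial>lebesgue) < \<eta>"
    by (auto simp: eventually_sequentially)
  show ?thesis
  proof (intro exI[of _ "max a (real n)"] conjI allI impI)
    fix s assume "max a (real n) \<le> s"
    hence "(\<integral>\<^sup>+ x\<in>{s..}. f x \<partial>lebesgue) \<le> (\<integral>\<^sup>+ x. u n x \<partial>lebesgue)"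
      by (intro nn_integral_mono) (auto simp: u_def indicator_def)
    with n show "(\<integral>\<^sup>+ x\<in>{s..}. f x \<partial>lebesgue) < \<eta>" by (rule le_less_trans[rotated])
  qed simp
qed

lemma nn_integral_le_const_interval:
  fixes f :: "real \<Rightarrow> real"
  assumes "s \<le> t" "0 \<le> B" "\<And>x. x \<in> {s..t} \<Longrightarrow> f x \<le> B"
  shows "(\<integral>\<^sup>+ x\<in>{s..t}. ennreal (f x) \<partial>lebesgue) \<le> ennreal (B * (t - s))"
proof -
  have "(\<integral>\<^sup>+ x\<in>{s..t}. ennreal (f x) \<partial>lebesgue) \<le> (\<integral>\<^sup>+ x. ennreal B * indicator {s..t} x \<partial>lebesgue)"
    using assms by (intro nn_integral_mono) (auto simp: indicator_def ennreal_leI)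
  also have "\<dots> = ennreal B * emeasure lebesgue {s..t}"
    by (rule nn_integral_cmult_indicator) simp
  also have "\<dots> = ennreal (B * (t - s))"
    using assms by (simp add: ennreal_mult)
  finally show ?thesis .
qed

lemma nn_integral_ge_const_interval:
  fixes f :: "real \<Rightarrow> real"
  assumes "s \<le> t" "0 \<le> B" "\<And>x. x \<in> {s..t} \<Longrightarrow> B \<le> f x"
  shows "ennreal (B * (t - s)) \<le> (\<integral>\<^sup>+ x\<in>{s..t}. ennreal (f x) \<partial>lebesgue)"
proof -
  have "ennreal (B * (t - s)) = ennreal B * emeasure lebesgue {s..t}"
    using assms by (simp add: ennreal_mult)
  also have "\<dots> = (\<integral>\<^sup>+ x. ennreal B * indicator {s..t} x \<partial>lebesgue)"
    by (rule nn_integral_cmult_indicator[symmetric]) simp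
  also have "\<dots> \<le> (\<integral>\<^sup>+ x\<in>{s..t}. ennreal (f x) \<partial>lebesgue)"
    using assms by (intro nn_integral_mono) (auto simp: indicator_def ennreal_leI)
  finally show ?thesis .
qed

text \<open>
  The window loses at most half of \<open>1 + t\<close>, because \<open>(1 + t) powr \<alpha> \<le> 1 + t\<close>; an
  exponent above \<open>1\<close> would make it reach back past \<open>0\<close> for large \<open>t\<close>.
\<close>

lemma window_start_ge:
  fixes t \<alpha> \<kappa> :: real
  assumes "\<alpha> \<le> 1" "0 \<le> \<kappa>" "\<kappa> \<le> 1/2" "3 \<le> t"
  shows "(1 + t) / 4 \<le> t - \<kappa> * (1 + t) powr \<alpha>"
proof -
  have "(1 + t) powr \<alpha> \<le> (1 + t) powr 1"
    using assms by (intro powr_mono) auto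
  hence "\<kappa> * (1 + t) powr \<alpha> \<le> 1/2 * (1 + t)"
    using assms by (intro mult_mono) auto
  thus ?thesis using \<open>3 \<le> t\<close> by simp
qed

text \<open>
  Every point of the window is comparable to \<open>t\<close>, so \<open>h\<close> is at most \<open>C * ((1 + t) / 4) powr -\<alpha>\<close>
  there; the length of the window cancels the dependence on \<open>t\<close> and leaves \<open>C * \<kappa> * 4 powr \<alpha>\<close>,
  where \<open>4 powr \<alpha> \<le> 4\<close>.
\<close>

lemma growth_over_window:
  fixes y h :: "real \<Rightarrow> real"
  assumes \<alpha>: "0 \<le> \<alpha>" "\<alpha> \<le> 1" and \<kappa>: "0 \<le> \<kappa>" "\<kappa> \<le> 1/2" and "0 \<le> C"
    and y_h: "ereal (y t - y r) \<le> enn2ereal (\<integral>\<^sup>+ \<xi>\<in>{r..t}. ennreal (h \<xi>) \<partial>lebesgue)"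
    and h_le: "\<And>\<xi>. \<xi> \<in> {r..t} \<Longrightarrow> h \<xi> * \<xi> powr \<alpha> \<le> C"
    and "3 \<le> t" and r: "t - \<kappa> * (1 + t) powr \<alpha> \<le> r" "r \<le> t"
  shows "y t - y r \<le> 4 * C * \<kappa>"
proof -
  define B where "B = C * 4 / (1 + t) powr \<alpha>"
  have "0 \<le> B" using \<open>0 \<le> C\<close> by (simp add: B_def)
  have "h \<xi> \<le> B" if \<xi>: "\<xi> \<in> {r..t}" for \<xi>
  proof -
    have "(1 + t) / 4 \<le> \<xi>"
      using window_start_ge[OF \<alpha>(2) \<kappa> \<open>3 \<le> t\<close>] r \<xi> by auto
    hence pos: "0 < \<xi>" and "1 + t \<le> 4 * \<xi>"
      using \<open>3 \<le> t\<close> by auto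
    hence "(1 + t) powr \<alpha> \<le> (4 * \<xi>) powr \<alpha>"
      using \<alpha> \<open>3 \<le> t\<close> by (intro powr_mono2) auto
    also have "\<dots> = 4 powr \<alpha> * \<xi> powr \<alpha>"
      using pos by (simp add: powr_mult)
    also have "\<dots> \<le> 4 * \<xi> powr \<alpha>"
      using \<alpha> powr_mono[of \<alpha> 1 4] by (intro mult_right_mono) auto
    finally have comparable: "(1 + t) powr \<alpha> \<le> 4 * \<xi> powr \<alpha>" .
    have "h \<xi> \<le> C / \<xi> powr \<alpha>"
      using h_le[OF \<xi>] pos by (simp add: field_simps)
    also have "\<dots> \<le> B"
      using mult_left_mono[OF comparable \<open>0 \<le> C\<close>] pos \<open>3 \<le> t\<close>
      by (simp add: B_def field_simps)
    finally show ?thesis .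
  qed
  hence "(\<integral>\<^sup>+ \<xi>\<in>{r..t}. ennreal (h \<xi>) \<partial>lebesgue) \<le> ennreal (B * (t - r))"
    using r(2) \<open>0 \<le> B\<close> by (intro nn_integral_le_const_interval) auto
  with y_h have "ereal (y t - y r) \<le> enn2ereal (ennreal (B * (t - r)))"
    by (meson order_trans less_eq_ennreal.rep_eq)
  hence "y t - y r \<le> B * (t - r)"
    using \<open>0 \<le> B\<close> r(2) by (simp add: enn2ereal_ennreal)
  also have "\<dots> \<le> B * (\<kappa> * (1 + t) powr \<alpha>)"
    using r \<open>0 \<le> B\<close> by (intro mult_left_mono) auto
  also have "\<dots> = 4 * C * \<kappa>"
    using \<open>3 \<le> t\<close> by (simp add: B_def)
  finally show ?thesis .
qed

theorem corollary2p10: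
  fixes \<omega> y h :: "real \<Rightarrow> real" and \<alpha> :: real
  assumes \<omega>_nonneg: "\<And>t. 0 \<le> t \<Longrightarrow> 0 \<le> \<omega> t"
    and \<omega>_mono: "mono_on {0..} \<omega>"
    and \<omega>_cont: "continuous_on {0..} \<omega>"
    and \<omega>_zero: "\<And>t. 0 \<le> t \<Longrightarrow> \<omega> t = 0 \<Longrightarrow> t = 0"
    and \<alpha>: "0 < \<alpha>" "\<alpha> \<le> 1"
    and y_nonneg: "\<And>t. 0 \<le> t \<Longrightarrow> 0 \<le> y t"
    and y_cont: "continuous_on {0..} y"
    and y_int: "(\<integral>\<^sup>+ t\<in>{0..}. ennreal (\<omega> (y t) * (1 / (1 + t) powr \<alpha>)) \<partial>lebesgue) < \<infinity>"
    and h_nonneg: "\<And>t. 0 \<le> t \<Longrightarrow> 0 \<le> h t"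
    and h_meas: "h \<in> borel_measurable (lebesgue_on {0..})"
    and y_h: "\<And>s t. 0 \<le> s \<Longrightarrow> s \<le> t \<Longrightarrow>
      ereal (y t - y s) \<le> enn2ereal (\<integral>\<^sup>+ \<xi>\<in>{s..t}. ennreal (h \<xi>) \<partial>lebesgue)"
    and h_limsup: "Limsup at_top (\<lambda>t. ereal (h t * t powr \<alpha>)) < \<infinity>"
  shows "(y \<longlongrightarrow> 0) at_top"
proof -
  define g where "g t = \<omega> (y t) * (1 / (1 + t) powr \<alpha>)" for t
  have g_meas: "(\<lambda>t. ennreal (g t) * indicator {0..} t) \<in> borel_measurable lebesgue"
  proof -
    have "continuous_on {0..} (\<lambda>t. \<omega> (y t))"
      using y_nonneg by (intro continuous_on_compose2[OF \<omega>_cont y_cont]) auto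
    hence "continuous_on {0..} g"
      unfolding g_def by (intro continuous_intros) auto
    hence "g \<in> borel_measurable (lebesgue_on {0..})"
      by (intro continuous_imp_measurable_on_sets_lebesgue) auto
    hence "(\<lambda>t. ennreal (g t)) \<in> borel_measurable (lebesgue_on {0..})"
      by (rule measurable_compose) simp
    thus ?thesis
      by (subst (asm) borel_measurable_restrict_space_iff_ennreal) auto
  qed

  obtain C0 :: real where C0: "Limsup at_top (\<lambda>t. ereal (h t * t powr \<alpha>)) < ereal C0"
    using ereal_dense2[OF h_limsup] by auto
  define C where "C = max C0 1"
  have "eventually (\<lambda>t. h t * t powr \<alpha> \<le> C) at_top"
    using Limsup_lessD[OF C0] by eventually_elim (auto simp: C_def)
  then obtain T0 where T0: "\<And>t. T0 \<le> t \<Longrightarrow> h t * t powr \<alpha> \<le> C"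
    by (auto simp: eventually_at_top_linorder)
  have "1 \<le> C" by (simp add: C_def)

  have small: "eventually (\<lambda>t. y t < 2 * e) at_top" if "0 < e" for e
  proof -
    define \<kappa> where "\<kappa> = min (1/2) (e / (4 * C))"
    have \<kappa>: "0 < \<kappa>" "\<kappa> \<le> 1/2" and growth: "4 * C * \<kappa> \<le> e"
      using \<open>0 < e\<close> \<open>1 \<le> C\<close> by (auto simp: \<kappa>_def min_def field_simps)
    have "0 < \<omega> e"
      using \<omega>_nonneg[of e] \<omega>_zero[of e] \<open>0 < e\<close> by force
    hence "0 < ennreal (\<omega> e * \<kappa>)" using \<kappa> by simp
    then obtain T where "0 \<le> T"
      and T: "\<And>s. T \<le> s \<Longrightarrow> (\<integral>\<^sup>+ t\<in>{s..}. ennreal (g t) \<partial>lebesgue) < ennreal (\<omega> e * \<kappa>)"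
      using nn_integral_tail_less[OF g_meas] y_int unfolding g_def by blast
    \<comment> \<open>A window ending at \<open>t\<close> starts after \<open>t / 4\<close>, so it then lies beyond both \<open>T\<close> and \<open>T0\<close>.\<close>
    have "y t < 2 * e" if t: "max 3 (4 * max T T0) \<le> t" for t
    proof (rule ccontr)
      assume "\<not> y t < 2 * e"
      define s where "s = t - \<kappa> * (1 + t) powr \<alpha>"
      have "3 \<le> t" and "s \<le> t" using t \<kappa> by (auto simp: s_def)
      have "(1 + t) / 4 \<le> s"
        unfolding s_def using \<alpha> \<kappa> \<open>3 \<le> t\<close> by (intro window_start_ge) auto
      hence s: "T \<le> s" "T0 \<le> s" "0 \<le> s" using t by auto
      have y_ge: "e \<le> y r" if r: "r \<in> {s..t}" for r
      proof -
        have "y t - y r \<le> 4 * C * \<kappa>"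
          using \<alpha> \<kappa> \<open>1 \<le> C\<close> \<open>3 \<le> t\<close> s r T0 y_h[of r t]
          by (intro growth_over_window[where h = h and \<alpha> = \<alpha>]) (auto simp: s_def)
        thus ?thesis using growth \<open>\<not> y t < 2 * e\<close> by linarith
      qed
      have g_ge: "\<omega> e / (1 + t) powr \<alpha> \<le> g r" if r: "r \<in> {s..t}" for r
      proof -
        have "\<omega> e \<le> \<omega> (y r)"
          using \<omega>_mono y_ge[OF r] \<open>0 < e\<close> by (auto intro: mono_onD)
        moreover have "(1 + r) powr \<alpha> \<le> (1 + t) powr \<alpha>"
          using r s \<alpha> by (intro powr_mono2) auto
        ultimately have "\<omega> e / (1 + t) powr \<alpha> \<le> \<omega> (y r) / (1 + r) powr \<alpha>"
          using \<open>0 < \<omega> e\<close> r s by (intro frac_le) auto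
        thus ?thesis by (simp add: g_def)
      qed
      have "ennreal (\<omega> e * \<kappa>) = ennreal (\<omega> e / (1 + t) powr \<alpha> * (t - s))"
        using \<open>3 \<le> t\<close> by (simp add: s_def)
      also have "\<dots> \<le> (\<integral>\<^sup>+ r\<in>{s..t}. ennreal (g r) \<partial>lebesgue)"
        using g_ge \<open>s \<le> t\<close> \<open>0 < \<omega> e\<close> by (intro nn_integral_ge_const_interval) auto
      also have "\<dots> \<le> (\<integral>\<^sup>+ r\<in>{s..}. ennreal (g r) \<partial>lebesgue)"
        by (intro nn_integral_mono) (auto simp: indicator_def)
      also have "\<dots> < ennreal (\<omega> e * \<kappa>)" using T s by blast
      finally show False by simp
    qed
    thus ?thesis unfolding eventually_at_top_linorder by blast
  qed

  show ?thesis
  proof (rule tendstoI)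
    fix e :: real assume "0 < e"
    hence "eventually (\<lambda>t. y t < 2 * (e / 2)) at_top" by (intro small) simp
    thus "eventually (\<lambda>t. dist (y t) 0 < e) at_top"
      using eventually_ge_at_top[of 0]
    proof eventually_elim
      case (elim t)
      thus ?case using y_nonneg[of t] by simp
    qed
  qed
qed

end
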